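(* Let $D=(V,A)$ be a digraph, let $b \in \mathbb{Z}_{++}^V$, and let $k$ be a positive integer. If $A$ can be partitioned into $k$ $b$-branchings, then $A$ can be partitioned into $k$ $b$-branchings $B_1,\ldots,B_k$ such that: (1) for each $i=1,\ldots,k$, $|B_i|$ equals $\lfloor |A|/k \rfloor$ or $\lceil |A|/k \rceil$; and (2) for each $i=1,\ldots,k$ and each vertex $v \in V$, the indegree $d^-_{B_i}(v)$ equals $\lfloor d^-_A(v)/k \rfloor$ or $\lceil d^-_A(v)/k \rceil$.
   Context: $\mathbb{Z}_{++}$ denotes the set of positive integers. For a digraph $D=(V,A)$ (finite, parallel arcs allowed), $F \subseteq A$ and $v \in V$, $d^-_F(v)$ is the number of arcs of $F$ with head $v$. For $X \subseteq V$, $b(X)=\sum_{v \in X} b(v)$ and $F[X]$ is the set of arcs of $F$ with both ends in $X$. An arc set $B \subseteq A$ is a $b$-branching if $d^-_B(v) \le b(v)$ for every $v \in V$ and $|B[X]| \le b(X)-1$ for every nonempty $X \subseteq V$. *)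

theory Defs
  imports Complex_Main "HOL-Library.Disjoint_Sets" "Graph_Theory.Digraph"
begin

definition arc_set_in_degree :: "('a, 'b) pre_digraph \<Rightarrow> 'b set \<Rightarrow> 'a \<Rightarrow> nat" where
  "arc_set_in_degree G F v = card {e \<in> F. head G e = v}"

definition induced_arcs :: "('a, 'b) pre_digraph \<Rightarrow> 'b set \<Rightarrow> 'a set \<Rightarrow> 'b set" where
  "induced_arcs G F X = {e \<in> F. tail G e \<in> X \<and> head G e \<in> X}"

(* The second bound is stated over the integers to avoid truncated subtraction. *)
definition b_branching :: "('a, 'b) pre_digraph \<Rightarrow> ('a \<Rightarrow> nat) \<Rightarrow> 'b set \<Rightarrow> bool" where
  "b_branching G b B \<longleftrightarrow>
     B \<subseteq> arcs G \<and>
     (\<forall>v \<in> verts G. arc_set_in_degree G B v \<le> b v) \<and>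
     (\<forall>X. X \<subseteq> verts G \<and> X \<noteq> {} \<longrightarrow>
        int (card (induced_arcs G B X)) \<le> int (\<Sum>v\<in>X. b v) - 1)"

(* An indexed family B 1, ..., B k rather than a set of parts (as in partition_on):
   the empty set is a b-branching, and parts may be empty (necessarily so if G has
   fewer than k arcs). *)
definition b_branching_partition ::
    "('a, 'b) pre_digraph \<Rightarrow> ('a \<Rightarrow> nat) \<Rightarrow> nat \<Rightarrow> (nat \<Rightarrow> 'b set) \<Rightarrow> bool" where
  "b_branching_partition G b k B \<longleftrightarrow>
     (\<forall>i \<in> {1..k}. b_branching G b (B i)) \<and>
     disjoint_family_on B {1..k} \<and>
     (\<Union>i \<in> {1..k}. B i) = arcs G"

end

(* Two arc sets with in-degrees c and c' can be chosen as b-branchings as soon as each contains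
   an ordinary branching spanning the vertices where its in-degree attains b, so prescribing the
   in-degrees reduces to Edmonds' disjoint branchings theorem for two branchings, proved by
   Lovasz's argument: grow the first branching by an arc entering no tight set.

   For the union A of two disjoint b-branchings, let c and c' round half the in-degree up or down.
   Edmonds' condition can only fail at a set entered by no arc.  A minimal such set M satisfies
   d_A(M) <= 2 b(M) - 2, hence contains a vertex of in-degree at most 2b - 2, which is harmless,
   or two vertices of in-degree 2b - 1; rounding these in opposite directions suffices, and since
   the minimal sets are disjoint this is compatible with an even split of all odd vertices.
   Repeated rebalancing of pairs of parts gives an equitable partition. *)

theory Submission
  imports Defs
begin

section \<open>Entering arcs and Edmonds' theorem for two disjoint branchings\<close>

definition entering :: "('a, 'b) pre_digraph \<Rightarrow> 'b set \<Rightarrow> 'a set \<Rightarrow> 'b set" where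
  "entering G F X = {e \<in> F. head G e \<in> X \<and> tail G e \<notin> X}"

lemma finite_entering: "finite F \<Longrightarrow> finite (entering G F X)"
  by (simp add: entering_def)

text \<open>An arc entering \<open>X \<inter> Y\<close> or \<open>X \<union> Y\<close> enters
  \<open>X\<close> or \<open>Y\<close>, and an arc entering both the intersection and the union
  enters both \<open>X\<close> and \<open>Y\<close>. So no arc is counted more often on the left
  than on the right.\<close>

lemma card_entering_submodular:
  assumes "finite F"
  shows "card (entering G F (X \<inter> Y)) + card (entering G F (X \<union> Y))
    \<le> card (entering G F X) + card (entering G F Y)"
proof -
  have fin: "finite (entering G F Z)" for Z
    using assms by (rule finite_entering)
  have "card (entering G F (X \<inter> Y)) + card (entering G F (X \<union> Y))
      = card (entering G F (X \<inter> Y) \<union> entering G F (X \<union> Y))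
        + card (entering G F (X \<inter> Y) \<inter> entering G F (X \<union> Y))"
    by (rule card_Un_Int[OF fin fin])
  also have "\<dots> \<le> card (entering G F X \<union> entering G F Y) + card (entering G F X \<inter> entering G F Y)"
    by (intro add_mono card_mono) (use fin in \<open>auto simp: entering_def\<close>)
  also have "\<dots> = card (entering G F X) + card (entering G F Y)"
    by (rule card_Un_Int[OF fin fin, symmetric])
  finally show ?thesis .
qed

text \<open>This is the invariant of Lovasz's greedy construction. \<open>F\<close> is the part of
  the first branching built so far, rooted outside \<open>S\<close>; it spans \<open>S - U\<close>,
  and the vertices of \<open>U\<close> are still to be reached. The arcs of \<open>A - F\<close>
  must always suffice for a second branching spanning \<open>T\<close>. The induction moves one
  vertex out of \<open>U\<close> at a time.\<close>

lemma branching_extension: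
  assumes "finite A" "finite S" "finite T"
    and "F \<subseteq> A" "U \<subseteq> S"
    and "head G ` F \<subseteq> S - U" "tail G ` F \<inter> U = {}"
    and "\<forall>v\<in>S - U. arc_set_in_degree G F v = 1"
    and "\<forall>X \<subseteq> S - U. X \<noteq> {} \<longrightarrow> entering G F X \<noteq> {}"
    and "\<forall>X \<subseteq> T. X \<noteq> {} \<longrightarrow> entering G (A - F) X \<noteq> {}"
    and "\<forall>X \<subseteq> U. X \<noteq> {} \<longrightarrow> entering G A X \<noteq> {}"
    and "\<forall>X \<subseteq> U \<inter> T. X \<noteq> {} \<longrightarrow> 2 \<le> card (entering G A X)"
  shows "\<exists>F'\<subseteq>A. head G ` F' \<subseteq> S \<and> (\<forall>v\<in>S. arc_set_in_degree G F' v = 1) \<and>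
    (\<forall>X \<subseteq> S. X \<noteq> {} \<longrightarrow> entering G F' X \<noteq> {}) \<and>
    (\<forall>X \<subseteq> T. X \<noteq> {} \<longrightarrow> entering G (A - F') X \<noteq> {})"
  using assms(4-)
proof (induction "card U" arbitrary: U F)
  case 0
  have "finite U"
    using "0.prems"(2) assms(2) by (rule finite_subset)
  then have "U = {}"
    using "0.hyps" by simp
  then show ?case
    using "0.prems" by (intro exI[of _ F]) simp
next
  case (Suc n U F)
  note prems = Suc.prems
  have finU: "finite U"
    using prems(2) assms(2) by (rule finite_subset)
  have finAF: "finite (A - F)"
    using assms(1) by simp
  have "U \<noteq> {}"
    using Suc.hyps(2) by auto
  \<comment> \<open>No arc of \<open>F\<close> has its head in \<open>U\<close>, so below
    \<open>U\<close> the hypotheses on \<open>A\<close> carry over to \<open>A - F\<close>.\<close>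
  have same: "entering G (A - F) X = entering G A X" if "X \<subseteq> U" for X
    using that prems(3) by (auto simp: entering_def)
  \<comment> \<open>A tight set has exactly one entering arc left; that arc cannot be given to the
    first branching.\<close>
  define tight where
    "tight X \<longleftrightarrow> X \<subseteq> T \<and> X \<noteq> {} \<and> card (entering G (A - F) X) = 1" for X
  have pos: "1 \<le> card (entering G (A - F) X)" if "X \<subseteq> T" "X \<noteq> {}" for X
    using prems(7) that finite_entering[OF finAF] by (simp add: Suc_le_eq card_gt_0_iff)
  have "\<exists>e\<in>A - F. head G e \<in> U \<and> tail G e \<notin> U \<and> (\<forall>Y. tight Y \<longrightarrow> e \<notin> entering G (A - F) Y)"
  proof (cases "\<exists>X. tight X \<and> X \<inter> U \<noteq> {}")
    case True
    then obtain X where X: "tight X" "X \<inter> U \<noteq> {}"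
      and least: "\<And>Y. tight Y \<and> Y \<inter> U \<noteq> {} \<Longrightarrow> card X \<le> card Y"
      using ex_has_least_nat[of "\<lambda>X. tight X \<and> X \<inter> U \<noteq> {}" _ card] by blast
    have finX: "finite X"
      using X(1) assms(3) finite_subset by (auto simp: tight_def)
    \<comment> \<open>A smallest tight set \<open>X\<close> meeting \<open>U\<close> is entered by
      one remaining arc, but \<open>X \<inter> U\<close> by at least two. Hence some remaining arc
      runs from \<open>X - U\<close> into \<open>X \<inter> U\<close>, and such an arc turns out to
      be safe.\<close>
    have two: "2 \<le> card (entering G (A - F) (X \<inter> U))"
      using prems(9) X same[of "X \<inter> U"] by (auto simp: tight_def)
    have "\<not> entering G (A - F) (X \<inter> U) \<subseteq> entering G (A - F) X"
    proof
      assume "entering G (A - F) (X \<inter> U) \<subseteq> entering G (A - F) X"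
      then have "card (entering G (A - F) (X \<inter> U)) \<le> card (entering G (A - F) X)"
        by (rule card_mono[OF finite_entering[OF finAF]])
      with two X(1) show False
        by (simp add: tight_def)
    qed
    then obtain e where e: "e \<in> A - F" "head G e \<in> X" "head G e \<in> U" "tail G e \<in> X" "tail G e \<notin> U"
      by (auto simp: entering_def)
    have "e \<notin> entering G (A - F) Y" if Y: "tight Y" for Y
    proof
      assume "e \<in> entering G (A - F) Y"
      then have eY: "head G e \<in> Y" "tail G e \<notin> Y"
        by (auto simp: entering_def)
      \<comment> \<open>Uncrossing: the intersection and the union are nonempty subsets of
        \<open>T\<close>, so each is entered at least once. Submodularity bounds the total by 2,
        hence \<open>X \<inter> Y\<close> is tight. It contains the head of \<open>e\<close>, thus
        meets \<open>U\<close>, but lacks the tail of \<open>e\<close>, against the minimality of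
        \<open>X\<close>.\<close>
      have "1 \<le> card (entering G (A - F) (X \<inter> Y))" "1 \<le> card (entering G (A - F) (X \<union> Y))"
        using X(1) Y e eY unfolding tight_def by (blast intro: pos)+
      moreover have "card (entering G (A - F) (X \<inter> Y)) + card (entering G (A - F) (X \<union> Y)) \<le> 2"
        using card_entering_submodular[OF finAF, of G X Y] X(1) Y by (simp add: tight_def)
      ultimately have "card (entering G (A - F) (X \<inter> Y)) = 1"
        by linarith
      then have "tight (X \<inter> Y)"
        using X(1) e eY by (auto simp: tight_def)
      then have "card X \<le> card (X \<inter> Y)"
        using e eY by (intro least) auto
      moreover have "card (X \<inter> Y) < card X"
        using e eY by (intro psubset_card_mono finX) auto
      ultimately show False
        by simp
    qed
    then show ?thesis
      using e by blast
  next
    case False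
    \<comment> \<open>If no tight set meets \<open>U\<close>, every arc entering \<open>U\<close> is
      safe, since its head lies in no tight set.\<close>
    obtain e where "e \<in> entering G (A - F) U"
      using prems(8) \<open>U \<noteq> {}\<close> same by blast
    with False show ?thesis
      by (intro bexI[of _ e]) (auto simp: entering_def)
  qed
  then obtain e where e: "e \<in> A - F" "head G e \<in> U" "tail G e \<notin> U"
    and notight: "\<And>Y. tight Y \<Longrightarrow> e \<notin> entering G (A - F) Y"
    by blast
  let ?F = "insert e F" and ?U = "U - {head G e}"
  show ?case
  proof (rule Suc.hyps(1))
    show "n = card ?U"
      using Suc.hyps(2) e(2) finU by simp
    show "?F \<subseteq> A" "?U \<subseteq> S"
      using prems e by auto
    show "head G ` ?F \<subseteq> S - ?U" "tail G ` ?F \<inter> ?U = {}"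
      using prems(2-4) e by auto
    show "\<forall>v\<in>S - ?U. arc_set_in_degree G ?F v = 1"
    proof
      fix v
      assume v: "v \<in> S - ?U"
      show "arc_set_in_degree G ?F v = 1"
      proof (cases "v = head G e")
        case True
        then have "{a \<in> ?F. head G a = v} = {e}"
          using prems(3) e by auto
        then show ?thesis
          by (simp add: arc_set_in_degree_def)
      next
        case False
        then have "{a \<in> ?F. head G a = v} = {a \<in> F. head G a = v}"
          by auto
        then show ?thesis
          using prems(5) v False by (simp add: arc_set_in_degree_def)
      qed
    qed
    show "\<forall>X \<subseteq> S - ?U. X \<noteq> {} \<longrightarrow> entering G ?F X \<noteq> {}"
    proof (intro allI impI)
      fix X
      assume X: "X \<subseteq> S - ?U" "X \<noteq> {}"
      show "entering G ?F X \<noteq> {}"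
      proof (cases "X - {head G e} = {}")
        case True
        then have "e \<in> entering G ?F X"
          using X e by (auto simp: entering_def)
        then show ?thesis
          by blast
      next
        case False
        \<comment> \<open>The new vertex \<open>head G e\<close> may be dropped from
          \<open>X\<close>: arcs of \<open>F\<close> have no tail in \<open>U\<close>, so an arc of
          \<open>F\<close> entering the smaller set does not start at that vertex and enters
          \<open>X\<close> as well.\<close>
        then obtain a where "a \<in> entering G F (X - {head G e})"
          using prems(6)[rule_format, of "X - {head G e}"] X by blast
        moreover from this have "tail G a \<noteq> head G e"
          using prems(4) e(2) by (auto simp: entering_def)
        ultimately have "a \<in> entering G ?F X"
          by (auto simp: entering_def)
        then show ?thesis
          by blast
      qed
    qed
    show "\<forall>X \<subseteq> T. X \<noteq> {} \<longrightarrow> entering G (A - ?F) X \<noteq> {}"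
    proof (intro allI impI)
      fix X
      assume X: "X \<subseteq> T" "X \<noteq> {}"
      have eq: "entering G (A - ?F) X = entering G (A - F) X - {e}"
        by (auto simp: entering_def)
      show "entering G (A - ?F) X \<noteq> {}"
      proof
        assume "entering G (A - ?F) X = {}"
        with eq prems(7) X have "entering G (A - F) X = {e}"
          by (metis Diff_eq_empty_iff subset_singletonD)
        moreover from this have "tight X"
          using X by (simp add: tight_def)
        ultimately show False
          using notight by blast
      qed
    qed
    show "\<forall>X \<subseteq> ?U. X \<noteq> {} \<longrightarrow> entering G A X \<noteq> {}"
      using prems(8) by blast
    show "\<forall>X \<subseteq> ?U \<inter> T. X \<noteq> {} \<longrightarrow> 2 \<le> card (entering G A X)"
      using prems(9) by blast
  qed
qed

text \<open>The extension lemma is applied twice. Started from the empty set with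
  \<open>U = S\<close>, it yields \<open>F\<close> and keeps the cut condition for \<open>T\<close>
  in \<open>A - F\<close>. Applied inside \<open>A - F\<close> with nothing left to protect, it
  yields \<open>F'\<close>.\<close>

lemma disjoint_branchings:
  assumes "finite A" "finite S" "finite T"
    and "\<forall>X \<subseteq> S. X \<noteq> {} \<longrightarrow> entering G A X \<noteq> {}"
    and "\<forall>X \<subseteq> T. X \<noteq> {} \<longrightarrow> entering G A X \<noteq> {}"
    and "\<forall>X \<subseteq> S \<inter> T. X \<noteq> {} \<longrightarrow> 2 \<le> card (entering G A X)"
  obtains F F' where "F \<subseteq> A" "F' \<subseteq> A" "F \<inter> F' = {}"
    "head G ` F \<subseteq> S" "\<forall>v\<in>S. arc_set_in_degree G F v = 1"
    "\<forall>X \<subseteq> S. X \<noteq> {} \<longrightarrow> entering G F X \<noteq> {}"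
    "head G ` F' \<subseteq> T" "\<forall>v\<in>T. arc_set_in_degree G F' v = 1"
    "\<forall>X \<subseteq> T. X \<noteq> {} \<longrightarrow> entering G F' X \<noteq> {}"
proof -
  obtain F where F: "F \<subseteq> A" "head G ` F \<subseteq> S" "\<forall>v\<in>S. arc_set_in_degree G F v = 1"
    "\<forall>X \<subseteq> S. X \<noteq> {} \<longrightarrow> entering G F X \<noteq> {}"
    "\<forall>X \<subseteq> T. X \<noteq> {} \<longrightarrow> entering G (A - F) X \<noteq> {}"
    using branching_extension[of A S T "{}" S G] assms by auto
  obtain F' where "F' \<subseteq> A - F" "head G ` F' \<subseteq> T" "\<forall>v\<in>T. arc_set_in_degree G F' v = 1"
    "\<forall>X \<subseteq> T. X \<noteq> {} \<longrightarrow> entering G F' X \<noteq> {}"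
    using branching_extension[of "A - F" T "{}" "{}" T G] assms F by auto
  with F show ?thesis
    by (intro that[of F F']) auto
qed

section \<open>Counting arcs by their heads, and \<open>b\<close>-branchings with prescribed
  in-degrees\<close>

lemma sum_in_degree:
  assumes "finite B" "finite X"
  shows "(\<Sum>v\<in>X. arc_set_in_degree G B v) = card {e \<in> B. head G e \<in> X}"
proof -
  have "card (\<Union>v\<in>X. {e \<in> B. head G e = v}) = (\<Sum>v\<in>X. card {e \<in> B. head G e = v})"
    using assms by (intro card_UN_disjoint) auto
  moreover have "(\<Union>v\<in>X. {e \<in> B. head G e = v}) = {e \<in> B. head G e \<in> X}"
    by auto
  ultimately show ?thesis
    by (simp add: arc_set_in_degree_def)
qed

lemma card_induced_plus_entering:
  assumes "finite B" "finite X"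
  shows "card (induced_arcs G B X) + card (entering G B X) = (\<Sum>v\<in>X. arc_set_in_degree G B v)"
proof -
  have "card (induced_arcs G B X \<union> entering G B X) = card (induced_arcs G B X) + card (entering G B X)"
    using assms by (intro card_Un_disjoint) (auto simp: induced_arcs_def entering_def)
  moreover have "induced_arcs G B X \<union> entering G B X = {e \<in> B. head G e \<in> X}"
    by (auto simp: induced_arcs_def entering_def)
  ultimately show ?thesis
    using sum_in_degree[OF assms, of G] by simp
qed

lemma in_degree_Un:
  assumes "finite B" "finite C" "B \<inter> C = {}"
  shows "arc_set_in_degree G (B \<union> C) v = arc_set_in_degree G B v + arc_set_in_degree G C v"
proof -
  have "card ({e \<in> B. head G e = v} \<union> {e \<in> C. head G e = v})
      = card {e \<in> B. head G e = v} + card {e \<in> C. head G e = v}"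
    using assms by (intro card_Un_disjoint) auto
  moreover have "{e \<in> B \<union> C. head G e = v} = {e \<in> B. head G e = v} \<union> {e \<in> C. head G e = v}"
    by auto
  ultimately show ?thesis
    by (simp add: arc_set_in_degree_def)
qed

text \<open>The arcs induced on \<open>X\<close> number the in-degree sum over \<open>X\<close>
  minus the arcs entering \<open>X\<close>. This falls below \<open>b(X)\<close> as soon as one
  vertex of \<open>X\<close> has in-degree less than \<open>b\<close>, so an entering arc is needed
  only for sets of saturated vertices.\<close>

lemma b_branchingI:
  assumes "finite (verts G)" "finite B" "B \<subseteq> arcs G"
    and "\<forall>v\<in>verts G. arc_set_in_degree G B v \<le> b v"
    and "\<And>X. X \<subseteq> {v \<in> verts G. arc_set_in_degree G B v = b v} \<Longrightarrow> X \<noteq> {} \<Longrightarrow> entering G B X \<noteq> {}"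
  shows "b_branching G b B"
proof -
  have "card (induced_arcs G B X) < (\<Sum>v\<in>X. b v)" if X: "X \<subseteq> verts G" "X \<noteq> {}" for X
  proof -
    have finX: "finite X"
      using X assms(1) finite_subset by blast
    have le: "(\<Sum>v\<in>X. arc_set_in_degree G B v) \<le> (\<Sum>v\<in>X. b v)"
      using X assms(4) by (intro sum_mono) auto
    note eq = card_induced_plus_entering[OF assms(2) finX, of G]
    show ?thesis
    proof (cases "\<exists>v\<in>X. arc_set_in_degree G B v < b v")
      case True
      then have "(\<Sum>v\<in>X. arc_set_in_degree G B v) < (\<Sum>v\<in>X. b v)"
        using X assms(4) finX by (intro sum_strict_mono_ex1) auto
      with eq show ?thesis
        by linarith
    next
      case False
      then have "entering G B X \<noteq> {}"
        using X assms(4) by (intro assms(5)) (auto simp: le_less)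
      then have "card (entering G B X) > 0"
        using finite_entering[OF assms(2)] by (simp add: card_gt_0_iff)
      with eq le show ?thesis
        by linarith
    qed
  qed
  then have "int (card (induced_arcs G B X)) \<le> int (\<Sum>v\<in>X. b v) - 1"
    if "X \<subseteq> verts G" "X \<noteq> {}" for X
    using that by (metis zle_diff1_eq of_nat_less_iff)
  then show ?thesis
    using assms(3,4) unfolding b_branching_def by blast
qed

text \<open>The three cut conditions are those of the disjoint branchings theorem for the vertices
  saturated by \<open>c\<close> and by \<open>c'\<close>. The two branchings found there supply
  entering arcs for all saturated sets; every other arc may go to either side, so it only has to be
  placed to meet the in-degrees.\<close>

lemma b_branchings_with_in_degrees:
  fixes b c c' :: "'a \<Rightarrow> nat"
  assumes fin: "finite A" "finite (verts G)" and "A \<subseteq> arcs G" and heads: "head G ` A \<subseteq> verts G"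
    and bpos: "\<forall>v\<in>verts G. 0 < b v"
    and deg: "\<forall>v\<in>verts G. arc_set_in_degree G A v = c v + c' v"
    and le: "\<forall>v\<in>verts G. c v \<le> b v \<and> c' v \<le> b v"
    and enter: "\<forall>X \<subseteq> {v \<in> verts G. c v = b v}. X \<noteq> {} \<longrightarrow> entering G A X \<noteq> {}"
    and enter': "\<forall>X \<subseteq> {v \<in> verts G. c' v = b v}. X \<noteq> {} \<longrightarrow> entering G A X \<noteq> {}"
    and enter2: "\<forall>X \<subseteq> {v \<in> verts G. c v = b v \<and> c' v = b v}. X \<noteq> {} \<longrightarrow>
      2 \<le> card (entering G A X)"
  obtains B B' where "b_branching G b B" "b_branching G b B'" "B \<inter> B' = {}" "B \<union> B' = A"
    "\<forall>v\<in>verts G. arc_set_in_degree G B v = c v \<and> arc_set_in_degree G B' v = c' v"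
proof -
  let ?S = "{v \<in> verts G. c v = b v}" and ?T = "{v \<in> verts G. c' v = b v}"
  have "?S \<inter> ?T = {v \<in> verts G. c v = b v \<and> c' v = b v}"
    by auto
  with enter2 have enter2': "\<forall>X \<subseteq> ?S \<inter> ?T. X \<noteq> {} \<longrightarrow> 2 \<le> card (entering G A X)"
    by simp
  obtain F F' where F: "F \<subseteq> A" "F' \<subseteq> A" "F \<inter> F' = {}"
    and FS: "head G ` F \<subseteq> ?S" "\<forall>v\<in>?S. arc_set_in_degree G F v = 1"
      "\<forall>X \<subseteq> ?S. X \<noteq> {} \<longrightarrow> entering G F X \<noteq> {}"
    and FT: "head G ` F' \<subseteq> ?T" "\<forall>v\<in>?T. arc_set_in_degree G F' v = 1"
      "\<forall>X \<subseteq> ?T. X \<noteq> {} \<longrightarrow> entering G F' X \<noteq> {}"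
    by (rule disjoint_branchings[OF fin(1) _ _ enter enter' enter2']) (use fin(2) in auto)
  have zero: "arc_set_in_degree G H v = 0" if "head G ` H \<subseteq> R" "v \<notin> R" for H R v
  proof -
    have "{e \<in> H. head G e = v} = {}"
      using that by blast
    then show ?thesis
      unfolding arc_set_in_degree_def by (metis card.empty)
  qed
  \<comment> \<open>The branchings fit into the prescribed in-degrees: \<open>F\<close> has
    in-degree 1 where \<open>c\<close> equals the positive value \<open>b\<close>, and 0 elsewhere;
    likewise \<open>F'\<close> and \<open>c'\<close>.\<close>
  have small: "arc_set_in_degree G F v \<le> c v" "arc_set_in_degree G F' v \<le> c' v"
    if "v \<in> verts G" for v
  proof -
    show "arc_set_in_degree G F v \<le> c v"
      using zero[OF FS(1), of v] FS(2) bpos that by (cases "v \<in> ?S") (auto simp: Suc_le_eq)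
    show "arc_set_in_degree G F' v \<le> c' v"
      using zero[OF FT(1), of v] FT(2) bpos that by (cases "v \<in> ?T") (auto simp: Suc_le_eq)
  qed
  have finF: "finite F" "finite F'"
    using F fin finite_subset by blast+
  \<comment> \<open>At each vertex the arcs of \<open>B\<close> are chosen independently, containing
    those of \<open>F\<close> and avoiding those of \<open>F'\<close>. Since \<open>F'\<close> takes
    at most \<open>c' v\<close> of the \<open>c v + c' v\<close> arcs, at least \<open>c v\<close>
    remain available.\<close>
  have "\<exists>P. {e \<in> F. head G e = v} \<subseteq> P \<and> P \<subseteq> {e \<in> A - F'. head G e = v} \<and> card P = c v"
    if v: "v \<in> verts G" for v
  proof (rule exists_subset_between)
    show "card {e \<in> F. head G e = v} \<le> c v"
      using small(1)[OF v] by (simp add: arc_set_in_degree_def)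
    have "A - F' \<union> F' = A"
      using F by auto
    then have "arc_set_in_degree G A v = arc_set_in_degree G (A - F') v + arc_set_in_degree G F' v"
      using in_degree_Un[of "A - F'" F' G v] fin finF by auto
    then have "c v \<le> arc_set_in_degree G (A - F') v"
      using bspec[OF deg v] small(2)[OF v] by linarith
    then show "c v \<le> card {e \<in> A - F'. head G e = v}"
      by (simp add: arc_set_in_degree_def)
  qed (use F fin in auto)
  then have "\<forall>v\<in>verts G. \<exists>P. {e \<in> F. head G e = v} \<subseteq> P \<and> P \<subseteq> {e \<in> A - F'. head G e = v} \<and> card P = c v"
    by blast
  from bchoice[OF this] obtain P where P: "\<And>v. v \<in> verts G \<Longrightarrow>
    {e \<in> F. head G e = v} \<subseteq> P v \<and> P v \<subseteq> {e \<in> A - F'. head G e = v} \<and> card (P v) = c v"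
    by blast
  define B where "B = (\<Union>v\<in>verts G. P v)"
  have BA: "B \<subseteq> A" "B \<inter> F' = {}"
    using P unfolding B_def by blast+
  have FB: "F \<subseteq> B"
  proof
    fix e
    assume "e \<in> F"
    moreover from this have "head G e \<in> verts G"
      using FS(1) by auto
    ultimately show "e \<in> B"
      using P[of "head G e"] by (auto simp: B_def)
  qed
  have FB': "F' \<subseteq> A - B"
    using F BA by auto
  have finB: "finite B" "finite (A - B)"
    using BA fin finite_subset by blast+
  have degB: "arc_set_in_degree G B v = c v" if v: "v \<in> verts G" for v
  proof -
    have "{e \<in> B. head G e = v} = P v"
      using P v unfolding B_def by blast
    then show ?thesis
      using P v by (simp add: arc_set_in_degree_def)
  qed
  have degB': "arc_set_in_degree G (A - B) v = c' v" if v: "v \<in> verts G" for v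
  proof -
    have "B \<union> (A - B) = A"
      using BA by auto
    then show ?thesis
      using in_degree_Un[of B "A - B" G v] finB deg v degB by auto
  qed
  show ?thesis
  proof (rule that[of B "A - B"])
    show "b_branching G b B"
    proof (rule b_branchingI[OF fin(2) finB(1)])
      fix X
      assume X: "X \<subseteq> {v \<in> verts G. arc_set_in_degree G B v = b v}" "X \<noteq> {}"
      then have "X \<subseteq> ?S"
        using degB by auto
      then show "entering G B X \<noteq> {}"
        using FS(3) FB X unfolding entering_def by blast
    qed (use BA assms degB in auto)
    show "b_branching G b (A - B)"
    proof (rule b_branchingI[OF fin(2) finB(2)])
      fix X
      assume X: "X \<subseteq> {v \<in> verts G. arc_set_in_degree G (A - B) v = b v}" "X \<noteq> {}"
      then have "X \<subseteq> ?T"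
        using degB' by auto
      then show "entering G (A - B) X \<noteq> {}"
        using FT(3) FB' X unfolding entering_def by blast
    qed (use BA assms degB' in auto)
  qed (use BA degB degB' in auto)
qed

section \<open>Splitting the odd vertices, and rebalancing two parts\<close>

lemma balanced_splitting:
  assumes "finite \<M>" "finite Q"
    and "\<forall>M\<in>\<M>. \<forall>N\<in>\<M>. M \<noteq> N \<longrightarrow> M \<inter> N = {}"
    and "\<forall>M\<in>\<M>. M \<subseteq> Q \<and> 2 \<le> card M"
  shows "\<exists>S\<subseteq>Q. (\<forall>M\<in>\<M>. M \<inter> S \<noteq> {} \<and> M - S \<noteq> {}) \<and>
    card S \<le> card (Q - S) + 1 \<and> card (Q - S) \<le> card S + 1"
  using assms
proof (induction \<M> arbitrary: Q rule: finite_induct)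
  case empty
  obtain S where "S \<subseteq> Q" "card S = card Q div 2"
    using obtain_subset_with_card_n[of "card Q div 2" Q] by auto
  then show ?case
    using card_Diff_subset[of S Q] empty.prems(1) finite_subset[of S Q]
    by (intro exI[of _ S]) auto
next
  case (insert M \<M> Q)
  have "2 \<le> card M"
    using insert.prems by simp
  \<comment> \<open>Put \<open>x\<close> on one side and \<open>y\<close> on the other. This splits
    \<open>M\<close>, raises both sizes by one, and leaves the other members of the family
    untouched, as they are disjoint from \<open>M\<close>.\<close>
  then obtain x y where xy: "x \<in> M" "y \<in> M" "x \<noteq> y"
    by (metis One_nat_def card.infinite card_le_Suc0_iff_eq not_less_eq_eq numeral_2_eq_2 zero_le)
  have "N \<inter> M = {}" if "N \<in> \<M>" for N
    using insert.prems(2) insert.hyps(2) that by (metis insertCI)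
  then have "\<forall>N\<in>\<M>. N \<subseteq> Q - {x, y} \<and> 2 \<le> card N"
    using insert.prems(3) xy by blast
  then obtain S where S: "S \<subseteq> Q - {x, y}" "\<forall>N\<in>\<M>. N \<inter> S \<noteq> {} \<and> N - S \<noteq> {}"
    "card S \<le> card (Q - {x, y} - S) + 1" "card (Q - {x, y} - S) \<le> card S + 1"
    using insert.IH[of "Q - {x, y}"] insert.prems by auto
  have xyQ: "x \<in> Q" "y \<in> Q"
    using insert.prems(3) xy by auto
  have finS: "finite S" "finite (Q - {x, y} - S)"
    using S(1) insert.prems(1) finite_subset by blast+
  have "Q - insert x S = insert y (Q - {x, y} - S)"
    using xy xyQ S(1) by auto
  then have "card (Q - insert x S) = Suc (card (Q - {x, y} - S))"
    using finS by simp
  moreover have "card (insert x S) = Suc (card S)"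
    using finS S(1) by (subst card_insert_disjoint) auto
  moreover have "x \<notin> N" if "N \<in> \<M>" for N
    using \<open>\<forall>N\<in>\<M>. N \<subseteq> Q - {x, y} \<and> 2 \<le> card N\<close> that by blast
  ultimately show ?case
    using S xy xyQ by (intro exI[of _ "insert x S"]) auto
qed


text \<open>All in-degrees of the union are halved, and one set \<open>S\<close> of odd vertices
  decides where to round up for the first part. Its balance against the remaining odd vertices
  controls the two sizes; its meeting each critical source set properly keeps both parts
  \<open>b\<close>-branchings.\<close>

lemma rebalance_pair:
  assumes "fin_digraph G" and bpos: "\<forall>v\<in>verts G. 0 < b v"
    and B1: "b_branching G b B1" and B2: "b_branching G b B2" and "B1 \<inter> B2 = {}"
  obtains B B' where "b_branching G b B" "b_branching G b B'" "B \<inter> B' = {}" "B \<union> B' = B1 \<union> B2"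
    "card B \<le> card B' + 1" "card B' \<le> card B + 1"
    "\<forall>v\<in>verts G. arc_set_in_degree G B v \<le> arc_set_in_degree G B' v + 1 \<and>
       arc_set_in_degree G B' v \<le> arc_set_in_degree G B v + 1"
proof -
  interpret fin_digraph G
    by fact
  let ?V = "verts G"
  define A where "A = B1 \<union> B2"
  define d where "d v = arc_set_in_degree G A v" for v
  have sub: "B1 \<subseteq> arcs G" "B2 \<subseteq> arcs G" "A \<subseteq> arcs G"
    using B1 B2 by (auto simp: b_branching_def A_def)
  then have fin: "finite B1" "finite B2" "finite A"
    using finite_subset[OF _ finite_arcs] by auto
  have heads: "head G ` A \<subseteq> ?V"
    using sub by auto
  have d_le: "d v \<le> 2 * b v" if "v \<in> ?V" for v
  proof -
    have "arc_set_in_degree G B1 v \<le> b v" "arc_set_in_degree G B2 v \<le> b v"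
      using B1 B2 that by (simp_all add: b_branching_def)
    then show ?thesis
      using in_degree_Un[OF fin(1,2) assms(5), of G v] by (simp add: d_def A_def)
  qed
  \<comment> \<open>The 2 on the left collects the \<open>- 1\<close> from each of the two
    \<open>b\<close>-branchings.\<close>
  have enter_bound: "(\<Sum>v\<in>X. d v) + 2 \<le> 2 * (\<Sum>v\<in>X. b v) + card (entering G A X)"
    if X: "X \<subseteq> ?V" "X \<noteq> {}" for X
  proof -
    have "induced_arcs G A X = induced_arcs G B1 X \<union> induced_arcs G B2 X"
      by (auto simp: induced_arcs_def A_def)
    then have "card (induced_arcs G A X) \<le> card (induced_arcs G B1 X) + card (induced_arcs G B2 X)"
      by (simp add: card_Un_le)
    moreover have "int (card (induced_arcs G B1 X)) \<le> int (\<Sum>v\<in>X. b v) - 1"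
      "int (card (induced_arcs G B2 X)) \<le> int (\<Sum>v\<in>X. b v) - 1"
      using B1 B2 X by (simp_all add: b_branching_def del: of_nat_sum)
    moreover have "card (induced_arcs G A X) + card (entering G A X) = (\<Sum>v\<in>X. d v)"
      unfolding d_def using X(1)
      by (intro card_induced_plus_entering fin) (rule finite_subset[OF _ finite_verts])
    ultimately show ?thesis
      by linarith
  qed
  define source where "source X \<longleftrightarrow> X \<subseteq> ?V \<and> X \<noteq> {} \<and> entering G A X = {}" for X
  \<comment> \<open>On \<open>W\<close> even the rounded-up half of \<open>d v\<close> stays below
    \<open>b v\<close>. Outside \<open>W\<close>, \<open>d v\<close> is \<open>2 * b v\<close> or
    one less, and the second case is exactly membership in \<open>Q\<close>. Thus only the minimal
    sources avoiding \<open>W\<close> constrain the rounding.\<close>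
  define W where "W = {v \<in> ?V. d v + 2 \<le> 2 * b v}"
  define Q where "Q = {v \<in> ?V. odd (d v)}"
  define \<N> where "\<N> = {M. source M \<and> (\<forall>Y\<subseteq>M. source Y \<longrightarrow> Y = M) \<and> M \<inter> W = {}}"
  have split_d: "2 * b v = d v + (if v \<in> Q then 1 else 0)" if "v \<in> ?V - W" for v
  proof -
    have v: "v \<in> ?V" and "d v = 2 * b v \<or> Suc (d v) = 2 * b v"
      using that d_le[of v] by (auto simp: W_def)
    moreover have "v \<in> Q \<longleftrightarrow> odd (d v)"
      using v by (simp add: Q_def)
    ultimately show ?thesis
      by (auto dest: arg_cong[of _ _ even])
  qed
  have disj: "M \<inter> N = {}" if "M \<in> \<N>" "N \<in> \<N>" "M \<noteq> N" for M N
  proof (rule ccontr)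
    assume "M \<inter> N \<noteq> {}"
    \<comment> \<open>Nonempty intersections of sources are sources, so distinct minimal ones are
      disjoint.\<close>
    moreover have "entering G A (M \<inter> N) \<subseteq> entering G A M \<union> entering G A N"
      by (auto simp: entering_def)
    ultimately have "source (M \<inter> N)"
      using that(1,2) by (auto simp: \<N>_def source_def)
    then have "M \<inter> N = M" "M \<inter> N = N"
      using that(1,2) by (simp_all add: \<N>_def)
    then show False
      using that(3) by simp
  qed
  have two: "2 \<le> card (M \<inter> Q)" if "M \<in> \<N>" for M
  proof -
    have M: "M \<subseteq> ?V" "M \<noteq> {}" "entering G A M = {}" "M \<inter> W = {}"
      using that by (auto simp: \<N>_def source_def)
    have finM: "finite M"
      using M(1) by (rule finite_subset) simp
    \<comment> \<open>The total deficit \<open>2 * b v - d v\<close> over \<open>M\<close> is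
      \<open>card (M \<inter> Q)\<close>, and \<open>enter_bound\<close> with no entering arc makes
      it at least 2.\<close>
    have "2 * (\<Sum>v\<in>M. b v) = (\<Sum>v\<in>M. d v + (if v \<in> Q then 1 else 0))"
      unfolding sum_distrib_left using M by (intro sum.cong split_d) auto
    also have "\<dots> = (\<Sum>v\<in>M. d v) + card (M \<inter> Q)"
      using finM by (simp add: sum.distrib sum.If_cases)
    finally show ?thesis
      using enter_bound[OF M(1,2)] M(3) by simp
  qed
  have "\<N> \<subseteq> Pow ?V"
    by (auto simp: \<N>_def source_def)
  then have fin\<N>: "finite \<N>"
    by (rule finite_subset) simp
  have finQ: "finite Q"
    by (simp add: Q_def)
  have "\<exists>S\<subseteq>Q. (\<forall>M\<in>(\<lambda>M. M \<inter> Q) ` \<N>. M \<inter> S \<noteq> {} \<and> M - S \<noteq> {}) \<and>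
    card S \<le> card (Q - S) + 1 \<and> card (Q - S) \<le> card S + 1"
    by (rule balanced_splitting) (use fin\<N> finQ disj two in auto)
  then obtain S where S: "S \<subseteq> Q" "card S \<le> card (Q - S) + 1" "card (Q - S) \<le> card S + 1"
    and "\<forall>M\<in>(\<lambda>M. M \<inter> Q) ` \<N>. M \<inter> S \<noteq> {} \<and> M - S \<noteq> {}"
    by blast
  then have meets: "\<And>M. M \<in> \<N> \<Longrightarrow> M \<inter> Q \<inter> S \<noteq> {} \<and> M \<inter> Q - S \<noteq> {}"
    by simp
  define c where "c v = d v div 2 + (if v \<in> S then 1 else 0)" for v
  define c' where "c' v = d v div 2 + (if v \<in> Q - S then 1 else 0)" for v
  have parity: "d v = 2 * (d v div 2) + (if v \<in> Q then 1 else 0)" if "v \<in> ?V" for v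
    using that by (simp add: Q_def)
  have sum_c: "d v = c v + c' v" if "v \<in> ?V" for v
    using parity[OF that] S(1) unfolding c_def c'_def by auto
  have c_le: "c v \<le> b v" "c' v \<le> b v" if "v \<in> ?V" for v
    using parity[OF that] S(1) d_le[OF that] unfolding c_def c'_def by (auto split: if_splits)
  have W_less: "c v < b v" "c' v < b v" if "v \<in> W" for v
    using that parity[of v] S(1) unfolding c_def c'_def W_def by (auto split: if_splits)
  have c_less: "c v < b v" if "v \<in> Q" "v \<notin> S" for v
    using that d_le[of v] unfolding c_def Q_def by (auto elim!: oddE)
  have c'_less: "c' v < b v" if "v \<in> Q" "v \<in> S" for v
    using that d_le[of v] unfolding c'_def Q_def by (auto elim!: oddE)
  \<comment> \<open>Pass to a minimal source inside \<open>X\<close>. If it meets \<open>W\<close>,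
    one vertex is deficient for both \<open>c\<close> and \<open>c'\<close>; otherwise its odd
    vertices outside \<open>S\<close> are deficient for \<open>c\<close> and those in
    \<open>S\<close> for \<open>c'\<close>.\<close>
  have source_deficient: "(\<exists>v\<in>X. c v < b v) \<and> (\<exists>v\<in>X. c' v < b v)" if X: "source X" for X
  proof -
    obtain M where M: "source M" "M \<subseteq> X"
      and least: "\<And>Y. source Y \<and> Y \<subseteq> X \<Longrightarrow> card M \<le> card Y"
      using ex_has_least_nat[of "\<lambda>M. source M \<and> M \<subseteq> X" X card] X by blast
    have finM: "finite M"
      using M(1) finite_subset[OF _ finite_verts] by (simp add: source_def)
    have "Y = M" if "Y \<subseteq> M" "source Y" for Y
      using least[of Y] that M(2) card_seteq[OF finM that(1)] by blast
    then have "M \<in> \<N>" if "M \<inter> W = {}"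
      using M(1) that by (simp add: \<N>_def)
    then show ?thesis
      using meets[of M] M(2) W_less c_less c'_less by (cases "M \<inter> W = {}") blast+
  qed
  have nonempty: "entering G A X \<noteq> {}" if "X \<subseteq> ?V" "X \<noteq> {}"
    "(\<forall>v\<in>X. c v = b v) \<or> (\<forall>v\<in>X. c' v = b v)" for X
  proof
    assume "entering G A X = {}"
    then have "source X"
      using that(1,2) by (simp add: source_def)
    then show False
      using source_deficient[of X] that(3) by auto
  qed
  have ge2: "2 \<le> card (entering G A X)" if "X \<subseteq> ?V" "X \<noteq> {}" "\<forall>v\<in>X. c v = b v \<and> c' v = b v" for X
  proof -
    \<comment> \<open>Saturation on both sides means zero deficit, so the slack 2 in
      \<open>enter_bound\<close> must come from entering arcs.\<close>
    have "(\<Sum>v\<in>X. d v) = (\<Sum>v\<in>X. 2 * b v)"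
      using that sum_c by (intro sum.cong) auto
    then show ?thesis
      using enter_bound[OF that(1,2)] by (simp add: sum_distrib_left)
  qed
  obtain B B' where B: "b_branching G b B" "b_branching G b B'" "B \<inter> B' = {}" "B \<union> B' = A"
    and degB: "\<forall>v\<in>?V. arc_set_in_degree G B v = c v \<and> arc_set_in_degree G B' v = c' v"
  proof (rule b_branchings_with_in_degrees[of A G b c c'])
    show "\<forall>v\<in>?V. arc_set_in_degree G A v = c v + c' v"
      using sum_c by (simp add: d_def)
    show "\<forall>X \<subseteq> {v \<in> ?V. c v = b v}. X \<noteq> {} \<longrightarrow> entering G A X \<noteq> {}"
      by (intro allI impI nonempty) auto
    show "\<forall>X \<subseteq> {v \<in> ?V. c' v = b v}. X \<noteq> {} \<longrightarrow> entering G A X \<noteq> {}"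
      by (intro allI impI nonempty) auto
    show "\<forall>X \<subseteq> {v \<in> ?V. c v = b v \<and> c' v = b v}. X \<noteq> {} \<longrightarrow> 2 \<le> card (entering G A X)"
      by (intro allI impI ge2) auto
  qed (use fin sub heads bpos c_le in auto)
  have card_sum: "card C = (\<Sum>v\<in>?V. arc_set_in_degree G C v)" if "C \<subseteq> A" for C
  proof -
    have "{e \<in> C. head G e \<in> ?V} = C"
      using that heads by auto
    moreover have "finite C"
      using that fin(3) by (rule finite_subset)
    ultimately show ?thesis
      using sum_in_degree[of C ?V G] by simp
  qed
  have "card B = (\<Sum>v\<in>?V. c v)" "card B' = (\<Sum>v\<in>?V. c' v)"
    using card_sum[of B] card_sum[of B'] B(4) degB by auto
  \<comment> \<open>The rounded-down halves are common to both sums, so the sizes differ only as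
    \<open>card S\<close> and \<open>card (Q - S)\<close> do.\<close>
  moreover have "(\<Sum>v\<in>?V. c v) = (\<Sum>v\<in>?V. d v div 2) + card S"
    "(\<Sum>v\<in>?V. c' v) = (\<Sum>v\<in>?V. d v div 2) + card (Q - S)"
  proof -
    have "?V \<inter> S = S" "?V \<inter> (Q - S) = Q - S"
      using S(1) by (auto simp: Q_def)
    moreover have "(\<Sum>v\<in>?V. if v \<in> R then 1 else 0) = card (?V \<inter> R)" for R :: "'a set"
      by (simp add: sum.If_cases)
    ultimately show "(\<Sum>v\<in>?V. c v) = (\<Sum>v\<in>?V. d v div 2) + card S"
      "(\<Sum>v\<in>?V. c' v) = (\<Sum>v\<in>?V. d v div 2) + card (Q - S)"
      unfolding c_def c'_def sum.distrib by metis+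
  qed
  ultimately have "card B \<le> card B' + 1" "card B' \<le> card B + 1"
    using S by auto
  moreover have "\<forall>v\<in>?V. arc_set_in_degree G B v \<le> arc_set_in_degree G B' v + 1 \<and>
       arc_set_in_degree G B' v \<le> arc_set_in_degree G B v + 1"
    using degB by (simp add: c_def c'_def)
  ultimately show ?thesis
    using B by (intro that[of B B']) (auto simp: A_def)
qed

section \<open>From balanced pairs to an equitable partition into \<open>k\<close> parts\<close>

lemma sum_squares_balanced:
  fixes x y x' y' :: nat
  assumes "x' + y' = x + y" "x' \<le> y' + 1" "y' \<le> x' + 1"
  shows "x' ^ 2 + y' ^ 2 \<le> x ^ 2 + y ^ 2"
    and "x > y + 1 \<Longrightarrow> x' ^ 2 + y' ^ 2 < x ^ 2 + y ^ 2"
proof -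
  have eq: "2 * (int p ^ 2 + int q ^ 2) = (int p + int q) ^ 2 + (int p - int q) ^ 2" for p q
    by (simp add: power2_eq_square algebra_simps)
  have s: "int x' + int y' = int x + int y"
    using assms(1) by linarith
  have small: "(int x' - int y') ^ 2 \<le> 1"
    using assms(2,3) by (simp add: abs_square_le_1)
  \<comment> \<open>With the sum fixed, \<open>eq\<close> reduces the claim to comparing
    differences. If \<open>x = y\<close>, the sum is even and forces \<open>x' = y'\<close>;
    otherwise the right side is a positive integer, hence at least 1.\<close>
  have "(int x' - int y') ^ 2 \<le> (int x - int y) ^ 2"
  proof (cases "x = y")
    case True
    then have "x' = y'"
      using assms by presburger
    then show ?thesis
      using True by simp
  next
    case False
    then have "0 < (int x - int y) ^ 2"
      by simp
    then show ?thesis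
      using small by linarith
  qed
  then have "int x' ^ 2 + int y' ^ 2 \<le> int x ^ 2 + int y ^ 2"
    using eq[of x' y'] eq[of x y] s by simp
  then show "x' ^ 2 + y' ^ 2 \<le> x ^ 2 + y ^ 2"
    by (metis of_nat_add of_nat_le_iff of_nat_power)
  assume "x > y + 1"
  then have "2 \<le> int x - int y"
    by linarith
  then have "2 ^ 2 \<le> (int x - int y) ^ 2"
    by (intro power_mono) auto
  then have "int x' ^ 2 + int y' ^ 2 < int x ^ 2 + int y ^ 2"
    using eq[of x' y'] eq[of x y] s small by simp
  then show "x' ^ 2 + y' ^ 2 < x ^ 2 + y ^ 2"
    by (metis of_nat_add of_nat_less_iff of_nat_power)
qed

text \<open>Comparing the other \<open>k - 1\<close> values with \<open>x i\<close> gives a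
  difference of at most \<open>k - 1\<close> between \<open>n\<close> and \<open>k * x i\<close>. So
  \<open>x i\<close> lies at distance less than 1 from \<open>n / k\<close>.\<close>

lemma floor_or_ceiling_of_balanced:
  fixes x :: "nat \<Rightarrow> nat"
  assumes "0 < k" "(\<Sum>i\<in>{1..k}. x i) = n"
    and bal: "\<forall>i\<in>{1..k}. \<forall>j\<in>{1..k}. x i \<le> x j + 1" and i: "i \<in> {1..k}"
  shows "int (x i) = \<lfloor>real n / real k\<rfloor> \<or> int (x i) = \<lceil>real n / real k\<rceil>"
proof -
  have n: "n = x i + (\<Sum>j\<in>{1..k} - {i}. x j)"
    using assms(2) i by (simp add: sum.remove)
  obtain m where k: "k = Suc m"
    using \<open>0 < k\<close> gr0_implies_Suc by blast
  then have card: "card ({1..k} - {i}) = m"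
    using i by simp
  have "(\<Sum>j\<in>{1..k} - {i}. x j) \<le> (\<Sum>j\<in>{1..k} - {i}. x i + 1)"
    using bal i by (intro sum_mono) auto
  then have upper: "(\<Sum>j\<in>{1..k} - {i}. x j) \<le> m * x i + m"
    using card by simp
  have "(\<Sum>j\<in>{1..k} - {i}. x i) \<le> (\<Sum>j\<in>{1..k} - {i}. x j + 1)"
    using bal i by (intro sum_mono) auto
  then have lower: "m * x i \<le> (\<Sum>j\<in>{1..k} - {i}. x j) + m"
    unfolding sum.distrib using card by simp
  have "k * x i = x i + m * x i"
    using k by simp
  then have "n < k * x i + k" "k * x i < n + k"
    using n k upper lower by linarith+
  then have "real n < real (k * x i + k)" "real (k * x i) < real (n + k)"
    by (simp_all only: of_nat_less_iff)
  then have "real n / real k < real (x i) + 1" "real (x i) < real n / real k + 1"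
    using \<open>0 < k\<close> by (simp_all add: field_simps)
  then show ?thesis
    by linarith
qed

text \<open>The partition minimising \<open>\<Sum>\<^sub>i (\<bar>B\<^sub>i\<bar>\<^sup>2 + \<Sum>\<^sub>v d\<^sub>i(v)\<^sup>2)\<close> cannot be improved
  by rebalancing two of its parts.\<close>

lemma balanced_partition:
  assumes G: "fin_digraph G" and bpos: "\<forall>v\<in>verts G. 0 < b v"
    and ex: "b_branching_partition G b k B0"
  obtains B where "b_branching_partition G b k B"
    "\<And>i j. i \<in> {1..k} \<Longrightarrow> j \<in> {1..k} \<Longrightarrow> card (B i) \<le> card (B j) + 1"
    "\<And>i j v. i \<in> {1..k} \<Longrightarrow> j \<in> {1..k} \<Longrightarrow> v \<in> verts G \<Longrightarrow>
       arc_set_in_degree G (B i) v \<le> arc_set_in_degree G (B j) v + 1"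
proof -
  interpret fin_digraph G
    by fact
  let ?V = "verts G" and ?d = "arc_set_in_degree G"
  \<comment> \<open>Size and all in-degrees enter one potential because rebalancing a pair increases
    none of these squared terms, so they can be minimised together.\<close>
  define q where "q C = card C ^ 2 + (\<Sum>v\<in>?V. ?d C v ^ 2)" for C
  define m where "m B = (\<Sum>i\<in>{1..k}. q (B i))" for B
  obtain B where B: "b_branching_partition G b k B"
    and least: "\<And>B'. b_branching_partition G b k B' \<Longrightarrow> m B \<le> m B'"
    using ex_has_least_nat[of "b_branching_partition G b k" B0 m] ex by blast
  have opt: "card (B i) \<le> card (B j) + 1 \<and> (\<forall>v\<in>?V. ?d (B i) v \<le> ?d (B j) v + 1)"
    if i: "i \<in> {1..k}" and j: "j \<in> {1..k}" and ij: "i \<noteq> j" for i j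
  proof -
    have Bij: "b_branching G b (B i)" "b_branching G b (B j)" "B i \<inter> B j = {}"
      using B i j ij by (auto simp: b_branching_partition_def disjoint_family_on_def)
    obtain C D where C: "b_branching G b C" "b_branching G b D" "C \<inter> D = {}" "C \<union> D = B i \<union> B j"
      and cards: "card C \<le> card D + 1" "card D \<le> card C + 1"
      and degs: "\<forall>v\<in>?V. ?d C v \<le> ?d D v + 1 \<and> ?d D v \<le> ?d C v + 1"
      using rebalance_pair[OF G bpos Bij] by metis
    have fins: "finite (B i)" "finite (B j)" "finite C" "finite D"
      using Bij C finite_subset[OF _ finite_arcs] by (auto simp: b_branching_def)
    have card_eq: "card C + card D = card (B i) + card (B j)"
      using card_Un_disjoint[of C D] card_Un_disjoint[of "B i" "B j"] fins Bij(3) C by simp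
    have deg_eq: "?d C v + ?d D v = ?d (B i) v + ?d (B j) v" for v
      using in_degree_Un[of C D G v] in_degree_Un[of "B i" "B j" G v] fins Bij(3) C by simp
    \<comment> \<open>The competitor exchanges only parts \<open>i\<close> and \<open>j\<close>; all
      other terms of \<open>m\<close> cancel in the comparison.\<close>
    define B' where "B' = B(i := C, j := D)"
    have B'_simps: "B' i = C" "B' j = D" "\<And>l. l \<noteq> i \<Longrightarrow> l \<noteq> j \<Longrightarrow> B' l = B l"
      using ij by (auto simp: B'_def)
    have "b_branching_partition G b k B'"
      unfolding b_branching_partition_def
    proof (intro conjI)
      show "\<forall>l\<in>{1..k}. b_branching G b (B' l)"
        using B C by (auto simp: B'_def b_branching_partition_def)
      have split: "(\<Union>l\<in>{1..k}. E l) = E i \<union> E j \<union> (\<Union>l\<in>{1..k} - {i, j}. E l)"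
        for E :: "nat \<Rightarrow> 'b set"
        using i j by blast
      have "(\<Union>l\<in>{1..k} - {i, j}. B' l) = (\<Union>l\<in>{1..k} - {i, j}. B l)"
        using B'_simps(3) by auto
      then have "(\<Union>l\<in>{1..k}. B' l) = (\<Union>l\<in>{1..k}. B l)"
        using split[of B'] split[of B] B'_simps C(4) by simp
      then show "(\<Union>l\<in>{1..k}. B' l) = arcs G"
        using B by (simp add: b_branching_partition_def)
      have disjB: "B l \<inter> B l' = {}" if "l \<in> {1..k}" "l' \<in> {1..k}" "l \<noteq> l'" for l l'
        using B that by (auto simp: b_branching_partition_def disjoint_family_on_def)
      have other: "B l \<inter> C = {}" "B l \<inter> D = {}" if "l \<in> {1..k}" "l \<noteq> i" "l \<noteq> j" for l
        using disjB[of l i] disjB[of l j] that i j C(4) by blast+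
      show "disjoint_family_on B' {1..k}"
        unfolding disjoint_family_on_def
      proof (intro ballI impI)
        fix l l'
        assume l: "l \<in> {1..k}" "l' \<in> {1..k}" "l \<noteq> l'"
        show "B' l \<inter> B' l' = {}"
          using disjB[OF l] other[of l] other[of l'] l C(3)
          by (auto simp: B'_def split: if_splits)
      qed
    qed
    then have "m B \<le> m B'"
      by (rule least)
    moreover have split_m: "m E = q (E i) + q (E j) + (\<Sum>l\<in>{1..k} - {i, j}. q (E l))" for E
    proof -
      have "{1..k} - {i, j} = {1..k} - {i} - {j}"
        by auto
      then show ?thesis
        unfolding m_def
        using sum.remove[of "{1..k}" i "\<lambda>l. q (E l)"]
          sum.remove[of "{1..k} - {i}" j "\<lambda>l. q (E l)"] i j ij by auto
    qed
    moreover have "(\<Sum>l\<in>{1..k} - {i, j}. q (B' l)) = (\<Sum>l\<in>{1..k} - {i, j}. q (B l))"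
      using B'_simps(3) by (intro sum.cong) auto
    ultimately have "q (B i) + q (B j) \<le> q C + q D"
      using split_m[of B] split_m[of B'] B'_simps by simp
    then have q_le: "card (B i) ^ 2 + card (B j) ^ 2 + (\<Sum>v\<in>?V. ?d (B i) v ^ 2 + ?d (B j) v ^ 2)
        \<le> card C ^ 2 + card D ^ 2 + (\<Sum>v\<in>?V. ?d C v ^ 2 + ?d D v ^ 2)"
      by (simp add: q_def sum.distrib)
    have card_sq: "card C ^ 2 + card D ^ 2 \<le> card (B i) ^ 2 + card (B j) ^ 2"
      by (rule sum_squares_balanced(1)[OF card_eq cards])
    have deg_sq: "?d C v ^ 2 + ?d D v ^ 2 \<le> ?d (B i) v ^ 2 + ?d (B j) v ^ 2" if "v \<in> ?V" for v
      using degs that by (intro sum_squares_balanced(1) deg_eq) auto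
    then have sum_sq: "(\<Sum>v\<in>?V. ?d C v ^ 2 + ?d D v ^ 2)
        \<le> (\<Sum>v\<in>?V. ?d (B i) v ^ 2 + ?d (B j) v ^ 2)"
      by (rule sum_mono)
    \<comment> \<open>A gap of 2 or more would make the size term drop strictly while the degree
      terms do not rise, against minimality. The in-degrees are handled in the same way, with one
      strict summand.\<close>
    have "card (B i) \<le> card (B j) + 1"
    proof (rule ccontr)
      assume "\<not> card (B i) \<le> card (B j) + 1"
      then have "card C ^ 2 + card D ^ 2 < card (B i) ^ 2 + card (B j) ^ 2"
        by (intro sum_squares_balanced(2)[OF card_eq cards]) auto
      then show False
        using q_le sum_sq by linarith
    qed
    moreover have "?d (B i) v \<le> ?d (B j) v + 1" if v: "v \<in> ?V" for v
    proof (rule ccontr)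
      assume "\<not> ?d (B i) v \<le> ?d (B j) v + 1"
      then have "?d C v ^ 2 + ?d D v ^ 2 < ?d (B i) v ^ 2 + ?d (B j) v ^ 2"
        using degs v by (intro sum_squares_balanced(2) deg_eq) auto
      then have "(\<Sum>v\<in>?V. ?d C v ^ 2 + ?d D v ^ 2) < (\<Sum>v\<in>?V. ?d (B i) v ^ 2 + ?d (B j) v ^ 2)"
        using v deg_sq by (intro sum_strict_mono_ex1) auto
      then show False
        using q_le card_sq by linarith
    qed
    ultimately show ?thesis
      by blast
  qed
  show ?thesis
  proof (rule that[OF B])
    show "card (B i) \<le> card (B j) + 1" if "i \<in> {1..k}" "j \<in> {1..k}" for i j
      using opt[OF that] by (cases "i = j") auto
    show "?d (B i) v \<le> ?d (B j) v + 1" if "i \<in> {1..k}" "j \<in> {1..k}" "v \<in> ?V" for i j v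
      using opt[OF that(1,2)] that(3) by (cases "i = j") auto
  qed
qed

theorem theorem1p6:
  fixes G :: "('a, 'b) pre_digraph"
    and b :: "'a \<Rightarrow> nat"
    and k :: nat
  assumes "fin_digraph G"
    and "\<forall>v \<in> verts G. b v > 0"
    and "k > 0"
    and "\<exists>B. b_branching_partition G b k B"
  shows "\<exists>B. b_branching_partition G b k B \<and>
    (\<forall>i \<in> {1..k}.
       int (card (B i)) = \<lfloor>real (card (arcs G)) / real k\<rfloor> \<or>
       int (card (B i)) = \<lceil>real (card (arcs G)) / real k\<rceil>) \<and>
    (\<forall>i \<in> {1..k}. \<forall>v \<in> verts G.
       int (arc_set_in_degree G (B i) v) = \<lfloor>real (in_degree G v) / real k\<rfloor> \<or>
       int (arc_set_in_degree G (B i) v) = \<lceil>real (in_degree G v) / real k\<rceil>)"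
proof -
  interpret fin_digraph G
    by fact
  obtain B where B: "b_branching_partition G b k B"
    and cards: "\<And>i j. i \<in> {1..k} \<Longrightarrow> j \<in> {1..k} \<Longrightarrow> card (B i) \<le> card (B j) + 1"
    and degs: "\<And>i j v. i \<in> {1..k} \<Longrightarrow> j \<in> {1..k} \<Longrightarrow> v \<in> verts G \<Longrightarrow>
       arc_set_in_degree G (B i) v \<le> arc_set_in_degree G (B j) v + 1"
    using balanced_partition[OF assms(1,2)] assms(4) by metis
  have fin: "finite (B i)" if "i \<in> {1..k}" for i
    using B that finite_subset[OF _ finite_arcs]
    by (auto simp: b_branching_partition_def b_branching_def)
  have disj: "B i \<inter> B j = {}" if "i \<in> {1..k}" "j \<in> {1..k}" "i \<noteq> j" for i j
    using B that by (auto simp: b_branching_partition_def disjoint_family_on_def)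
  have arcs: "arcs G = (\<Union>i\<in>{1..k}. B i)"
    using B by (simp add: b_branching_partition_def)
  \<comment> \<open>Sizes and in-degrees of the parts add up to those of the whole digraph, so the
    floor-or-ceiling lemma applies to each of these families of \<open>k\<close> numbers.\<close>
  have sum_card: "(\<Sum>i\<in>{1..k}. card (B i)) = card (arcs G)"
    unfolding arcs using fin disj by (subst card_UN_disjoint) auto
  have sum_deg: "(\<Sum>i\<in>{1..k}. arc_set_in_degree G (B i) v) = in_degree G v" for v
  proof -
    have "in_arcs G v = (\<Union>i\<in>{1..k}. {e \<in> B i. head G e = v})"
      unfolding in_arcs_def arcs by auto
    moreover have "card (\<Union>i\<in>{1..k}. {e \<in> B i. head G e = v})
        = (\<Sum>i\<in>{1..k}. card {e \<in> B i. head G e = v})"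
    proof (intro card_UN_disjoint ballI impI)
      fix i j
      assume "i \<in> {1..k}" "j \<in> {1..k}" "i \<noteq> j"
      then have "B i \<inter> B j = {}"
        by (rule disj)
      then show "{e \<in> B i. head G e = v} \<inter> {e \<in> B j. head G e = v} = {}"
        by blast
    qed (use fin in auto)
    ultimately show ?thesis
      by (simp add: in_degree_def arc_set_in_degree_def)
  qed
  show ?thesis
  proof (intro exI[of _ B] conjI ballI)
    show "int (card (B i)) = \<lfloor>real (card (arcs G)) / real k\<rfloor> \<or>
        int (card (B i)) = \<lceil>real (card (arcs G)) / real k\<rceil>" if "i \<in> {1..k}" for i
      by (rule floor_or_ceiling_of_balanced[OF \<open>k > 0\<close> sum_card _ that]) (intro ballI cards)
    show "int (arc_set_in_degree G (B i) v) = \<lfloor>real (in_degree G v) / real k\<rfloor> \<or>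
        int (arc_set_in_degree G (B i) v) = \<lceil>real (in_degree G v) / real k\<rceil>"
      if "i \<in> {1..k}" "v \<in> verts G" for i v
      by (rule floor_or_ceiling_of_balanced[OF \<open>k > 0\<close> sum_deg _ that(1)]) (intro ballI degs that(2))
  qed (rule B)
qed

end
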